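(* Let $(G,s_G,t_G)$ be a cat$^1$-group with operations in $\mathsf{C}$ and $(N,s_N,t_N)$ a normal subcat$^1$-group with operations of $(G,s_G,t_G)$. If $(A,B,\alpha)$ and $(S,T,\sigma)$ are the crossed modules corresponding to $(G,s_G,t_G)$ and $(N,s_N,t_N)$ respectively, then $(S,T,\sigma)$ is a normal subcrossed module of $(A,B,\alpha)$ in $\mathsf{C}$.
   Context: Groups with operations. $\mathsf{C}$ is a fixed category of groups with operations: its objects are the algebras with a set $\Omega$ of operations satisfying a set $\mathsf{E}$ of identities, where $\mathsf{E}$ includes the group laws and, with $\Omega_i$ the set of $i$-ary operations: (a) $\Omega=\Omega_0\cup\Omega_1\cup\Omega_2$; (b) the group operations $0,-,+$ (written additively, $+$ not necessarily commutative) belong to $\Omega_0,\Omega_1,\Omega_2$ respectively, $\Omega_0=\{0\}$, and with $\Omega_1'=\Omega_1\setminus\{-\}$, $\Omega_2'=\Omega_2\setminus\{+\}$, if $\star\in\Omega_2'$ then the operation $a\star^{\circ}b=b\star a$ is also in $\Omega_2'$; (c) for each $\star\in\Omega_2'$, $\mathsf{E}$ includes $a\star(b+c)=a\star b+a\star c$; (d) for $\omega\in\Omega_1'$, $\star\in\Omega_2'$, $\mathsf{E}$ includes $\omega(a+b)=\omega(a)+\omega(b)$ and $\omega(a)\star b=\omega(a\star b)$. Morphisms are group homomorphisms preserving all operations in $\Omega_1'$ and $\Omega_2'$. A subobject is a subset containing $0$ and closed under all operations. An ideal $N$ of $A$ is a subobject with $(N,+)$ normal in $(A,+)$ and $a\star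 n\in N$ for all $a\in A$, $n\in N$, $\star\in\Omega_2'$. Crossed modules. Derived actions of $B$ on $A$ (objects of $\mathsf{C}$) are the maps $b\cdot a=s(b)+a-s(b)$ and $b\star a=s(b)\star a$ ($\star\in\Omega_2'$) obtained from a split extension $0\to A\to E\xrightarrow{p}B\to 0$ in $\mathsf{C}$ ($p$ surjective, $A=\ker p$, $s\colon B\to E$ a morphism with $ps=\mathrm{id}_B$). One writes $a\star b:=b\star^{\circ}a$. A crossed module $(A,B,\alpha)$ in $\mathsf{C}$ consists of objects $A,B$, derived actions of $B$ on $A$, and a morphism $\alpha\colon A\to B$ such that for all $b\in B$, $a,a'\in A$, $\star\in\Omega_2'$: $\alpha(b\cdot a)=b+\alpha(a)-b$; $\alpha(a)\cdot a'=a+a'-a$; $\alpha(a)\star a'=a\star a'$; $\alpha(b\star a)=b\star\alpha(a)$ and $\alpha(a\star b)=\alpha(a)\star b$. A crossed module $(S,T,\sigma)$ is a subcrossed module of $(A,B,\alpha)$ if $S\subseteq A$ and $T\subseteq B$ are subobjects, $\sigma$ is the restriction of $\alpha$, and the actions of $T$ on $S$ are induced by those of $B$ on $A$. It is normal if: $T$ is an ideal of $B$; $b\cdot s\in S$, $(t\cdot a)-a\in S$, $b\star s\in S$, $t\star a\in S$ for all $b\in B,s\in S,t\in T,a\in A$, $\star\in\Omega_2'$. Cat$^1$-groups with operations. A cat$^1$-group with operations is a triple $(G,s,t)$ with $G$ an object of $\mathsf{C}$ and $s,t$ endomorphisms of $G$ in $\mathsf{C}$ such that $st=t$, $ts=s$,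 elements of $\ker s$ and $\ker t$ commute under $+$, and $x\star y=0$ for $x\in\ker s$, $y\in\ker t$, $\star\in\Omega_2'$. A cat$^1$-group with operations $(N,s_N,t_N)$ is a normal subcat$^1$-group with operations of $(G,s_G,t_G)$ if $N$ is an ideal of $G$ and $s_N,t_N$ are the restrictions of $s_G,t_G$ to $N$. The crossed module corresponding to $(G,s,t)$ is $(\ker s,\operatorname{Im}s,t|_{\ker s})$ with actions $b\cdot a=b+a-b$ and $b\star a$ computed in $G$ (for $b\in\operatorname{Im}s$, $a\in\ker s$). *)

theory Defs
  imports "HOL-Algebra.Coset"
begin

section \<open>Groups with operations\<close>

datatype (unsyms: 'u, binsyms: 'o) gwo_term =
    Var nat
  | Zero
  | Neg "('u, 'o) gwo_term"
  | Plus "('u, 'o) gwo_term" "('u, 'o) gwo_term"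
  | UnOp 'u "('u, 'o) gwo_term"
  | BinOp 'o "('u, 'o) gwo_term" "('u, 'o) gwo_term"

text \<open>
  The fields \<open>unops\<close> and \<open>binops\<close> are \<open>\<Omega>\<^sub>1'\<close> and \<open>\<Omega>\<^sub>2'\<close>: the symbols other than
  \<open>0\<close>, \<open>-\<close>, \<open>+\<close>, for which the term language has constructors of its own.
  The symbol \<open>opp f\<close> is the operation \<open>f\<^sup>\<circ>\<close>, and \<open>idents\<close> is \<open>E\<close>,
  whose elements \<open>(l, r)\<close> stand for the identities \<open>l = r\<close>.
\<close>

record ('u, 'o) gwo_category =
  unops :: "'u set"
  binops :: "'o set"
  opp :: "'o \<Rightarrow> 'o"
  idents :: "(('u, 'o) gwo_term \<times> ('u, 'o) gwo_term) set"

definition wf_term :: "('u, 'o) gwo_category \<Rightarrow> ('u, 'o) gwo_term \<Rightarrow> bool" where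
  "wf_term C t \<longleftrightarrow> unsyms t \<subseteq> unops C \<and> binsyms t \<subseteq> binops C"

definition group_laws :: "(('u, 'o) gwo_term \<times> ('u, 'o) gwo_term) set" where
  "group_laws =
    {(Plus (Plus (Var 0) (Var 1)) (Var 2), Plus (Var 0) (Plus (Var 1) (Var 2))),
     (Plus Zero (Var 0), Var 0),
     (Plus (Var 0) Zero, Var 0),
     (Plus (Neg (Var 0)) (Var 0), Zero),
     (Plus (Var 0) (Neg (Var 0)), Zero)}"

definition gwo_category :: "('u, 'o) gwo_category \<Rightarrow> bool" where
  "gwo_category C \<longleftrightarrow>
     (\<forall>(l, r) \<in> idents C. wf_term C l \<and> wf_term C r) \<and>
     group_laws \<subseteq> idents C \<and>
     (\<forall>f \<in> binops C. opp C f \<in> binops C \<and>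
        (BinOp (opp C f) (Var 0) (Var 1), BinOp f (Var 1) (Var 0)) \<in> idents C) \<and>
     (\<forall>f \<in> binops C.
        (BinOp f (Var 0) (Plus (Var 1) (Var 2)),
         Plus (BinOp f (Var 0) (Var 1)) (BinOp f (Var 0) (Var 2))) \<in> idents C) \<and>
     (\<forall>w \<in> unops C.
        (UnOp w (Plus (Var 0) (Var 1)), Plus (UnOp w (Var 0)) (UnOp w (Var 1))) \<in> idents C) \<and>
     (\<forall>w \<in> unops C. \<forall>f \<in> binops C.
        (BinOp f (UnOp w (Var 0)) (Var 1), UnOp w (BinOp f (Var 0) (Var 1))) \<in> idents C)"

text \<open>
  Algebras extend the group records of HOL-Algebra, so the operations written
  \<open>0\<close>, \<open>-a\<close>, \<open>a + b\<close> in the literature appear here as \<open>\<one>\<close>, \<open>inv a\<close>, \<open>a \<otimes> b\<close>;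
  commutativity is not assumed. Operation symbols outside \<open>unops C\<close> and
  \<open>binops C\<close> are interpreted arbitrarily and never referred to.
\<close>

record ('a, 'u, 'o) gwo = "'a monoid" +
  unop :: "'u \<Rightarrow> 'a \<Rightarrow> 'a"
  binop :: "'o \<Rightarrow> 'a \<Rightarrow> 'a \<Rightarrow> 'a"

primrec term_val :: "('a, 'u, 'o) gwo \<Rightarrow> (nat \<Rightarrow> 'a) \<Rightarrow> ('u, 'o) gwo_term \<Rightarrow> 'a" where
  "term_val G \<rho> (Var n) = \<rho> n"
| "term_val G \<rho> Zero = \<one>\<^bsub>G\<^esub>"
| "term_val G \<rho> (Neg t) = inv\<^bsub>G\<^esub> (term_val G \<rho> t)"
| "term_val G \<rho> (Plus t u) = term_val G \<rho> t \<otimes>\<^bsub>G\<^esub> term_val G \<rho> u"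
| "term_val G \<rho> (UnOp w t) = unop G w (term_val G \<rho> t)"
| "term_val G \<rho> (BinOp f t u) = binop G f (term_val G \<rho> t) (term_val G \<rho> u)"

text \<open>
  The group laws belong to \<open>idents C\<close>; that objects are groups in the sense of
  HOL-Algebra is lemma \<open>object_group\<close>.
\<close>

definition gwo_object :: "('u, 'o) gwo_category \<Rightarrow> ('a, 'u, 'o) gwo \<Rightarrow> bool" where
  "gwo_object C G \<longleftrightarrow>
     \<one>\<^bsub>G\<^esub> \<in> carrier G \<and>
     (\<forall>x \<in> carrier G. inv\<^bsub>G\<^esub> x \<in> carrier G) \<and>
     (\<forall>x \<in> carrier G. \<forall>y \<in> carrier G. x \<otimes>\<^bsub>G\<^esub> y \<in> carrier G) \<and>
     (\<forall>w \<in> unops C. \<forall>x \<in> carrier G. unop G w x \<in> carrier G) \<and>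
     (\<forall>f \<in> binops C. \<forall>x \<in> carrier G. \<forall>y \<in> carrier G. binop G f x y \<in> carrier G) \<and>
     (\<forall>(l, r) \<in> idents C. \<forall>\<rho>. range \<rho> \<subseteq> carrier G \<longrightarrow> term_val G \<rho> l = term_val G \<rho> r)"

definition gwo_hom ::
  "('u, 'o) gwo_category \<Rightarrow> ('a, 'u, 'o) gwo \<Rightarrow> ('b, 'u, 'o) gwo \<Rightarrow> ('a \<Rightarrow> 'b) set" where
  "gwo_hom C G H =
     {h \<in> hom G H.
        (\<forall>w \<in> unops C. \<forall>x \<in> carrier G. h (unop G w x) = unop H w (h x)) \<and>
        (\<forall>f \<in> binops C. \<forall>x \<in> carrier G. \<forall>y \<in> carrier G.
           h (binop G f x y) = binop H f (h x) (h y))}"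

text \<open>A subobject is an algebra on a subset of the carrier, with the induced operations.\<close>

definition gwo_subobject ::
  "('u, 'o) gwo_category \<Rightarrow> ('a, 'u, 'o) gwo \<Rightarrow> ('a, 'u, 'o) gwo \<Rightarrow> bool" where
  "gwo_subobject C H G \<longleftrightarrow>
     subgroup (carrier H) G \<and>
     (\<forall>w \<in> unops C. \<forall>x \<in> carrier H. unop G w x \<in> carrier H) \<and>
     (\<forall>f \<in> binops C. \<forall>x \<in> carrier H. \<forall>y \<in> carrier H. binop G f x y \<in> carrier H) \<and>
     \<one>\<^bsub>H\<^esub> = \<one>\<^bsub>G\<^esub> \<and>
     (\<forall>x \<in> carrier H. inv\<^bsub>H\<^esub> x = inv\<^bsub>G\<^esub> x) \<and>
     (\<forall>x \<in> carrier H. \<forall>y \<in> carrier H. x \<otimes>\<^bsub>H\<^esub> y = x \<otimes>\<^bsub>G\<^esub> y) \<and>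
     (\<forall>w \<in> unops C. \<forall>x \<in> carrier H. unop H w x = unop G w x) \<and>
     (\<forall>f \<in> binops C. \<forall>x \<in> carrier H. \<forall>y \<in> carrier H. binop H f x y = binop G f x y)"

definition gwo_ideal ::
  "('u, 'o) gwo_category \<Rightarrow> ('a, 'u, 'o) gwo \<Rightarrow> ('a, 'u, 'o) gwo \<Rightarrow> bool" where
  "gwo_ideal C N G \<longleftrightarrow>
     gwo_subobject C N G \<and> carrier N \<lhd> G \<and>
     (\<forall>f \<in> binops C. \<forall>a \<in> carrier G. \<forall>n \<in> carrier N. binop G f a n \<in> carrier N)"


section \<open>Derived actions and crossed modules\<close>

text \<open>
  \<open>A\<close> is identified with \<open>ker p\<close> along the injective morphism \<open>i\<close>.
\<close>

definition split_extension ::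
  "('u, 'o) gwo_category \<Rightarrow> ('a, 'u, 'o) gwo \<Rightarrow> ('e, 'u, 'o) gwo \<Rightarrow> ('b, 'u, 'o) gwo
     \<Rightarrow> ('a \<Rightarrow> 'e) \<Rightarrow> ('e \<Rightarrow> 'b) \<Rightarrow> ('b \<Rightarrow> 'e) \<Rightarrow> bool" where
  "split_extension C A E B i p s \<longleftrightarrow>
     gwo_object C A \<and> gwo_object C E \<and> gwo_object C B \<and>
     i \<in> gwo_hom C A E \<and> p \<in> gwo_hom C E B \<and> s \<in> gwo_hom C B E \<and>
     inj_on i (carrier A) \<and> i ` carrier A = kernel E B p \<and>
     p ` carrier E = carrier B \<and> (\<forall>b \<in> carrier B. p (s b) = b)"

definition induces_action ::
  "('u, 'o) gwo_category \<Rightarrow> ('a, 'u, 'o) gwo \<Rightarrow> ('e, 'u, 'o) gwo \<Rightarrow> ('b, 'u, 'o) gwo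
     \<Rightarrow> ('a \<Rightarrow> 'e) \<Rightarrow> ('b \<Rightarrow> 'e) \<Rightarrow> ('b \<Rightarrow> 'a \<Rightarrow> 'a) \<Rightarrow> ('o \<Rightarrow> 'b \<Rightarrow> 'a \<Rightarrow> 'a) \<Rightarrow> bool" where
  "induces_action C A E B i s dot star \<longleftrightarrow>
     (\<forall>b \<in> carrier B. \<forall>a \<in> carrier A.
        dot b a \<in> carrier A \<and> i (dot b a) = s b \<otimes>\<^bsub>E\<^esub> i a \<otimes>\<^bsub>E\<^esub> inv\<^bsub>E\<^esub> (s b)) \<and>
     (\<forall>f \<in> binops C. \<forall>b \<in> carrier B. \<forall>a \<in> carrier A.
        star f b a \<in> carrier A \<and> i (star f b a) = binop E f (s b) (i a))"

text \<open>
  HOL cannot quantify over the type of the middle object inside a definition. Taking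
  it to be \<open>'a \<times> 'b\<close> loses nothing, since \<open>E\<close> is in bijection with
  \<open>A \<times> B\<close>; see lemma \<open>derived_actionsI\<close>, where the type of \<open>E\<close> is arbitrary.
\<close>

definition derived_actions ::
  "('u, 'o) gwo_category \<Rightarrow> ('b, 'u, 'o) gwo \<Rightarrow> ('a, 'u, 'o) gwo
     \<Rightarrow> ('b \<Rightarrow> 'a \<Rightarrow> 'a) \<Rightarrow> ('o \<Rightarrow> 'b \<Rightarrow> 'a \<Rightarrow> 'a) \<Rightarrow> bool" where
  "derived_actions C B A dot star \<longleftrightarrow>
     (\<exists>(E :: ('a \<times> 'b, 'u, 'o) gwo) i p s.
        split_extension C A E B i p s \<and> induces_action C A E B i s dot star)"

record ('a, 'b, 'u, 'o) xmod =
  xdom :: "('a, 'u, 'o) gwo"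
  xcod :: "('b, 'u, 'o) gwo"
  xmap :: "'a \<Rightarrow> 'b"
  xdot :: "'b \<Rightarrow> 'a \<Rightarrow> 'a"
  xstar :: "'o \<Rightarrow> 'b \<Rightarrow> 'a \<Rightarrow> 'a"

text \<open>
  For \<open>a\<close> in \<open>A\<close> and \<open>b\<close> in \<open>B\<close>, the element \<open>a \<star> b\<close> is by convention
  \<open>b \<star>\<^sup>\<circ> a\<close>, that is, \<open>xstar X (opp C f) b a\<close>.
\<close>

definition crossed_module ::
  "('u, 'o) gwo_category \<Rightarrow> ('a, 'b, 'u, 'o) xmod \<Rightarrow> bool" where
  "crossed_module C X \<longleftrightarrow>
     (let A = xdom X; B = xcod X; \<alpha> = xmap X in
        gwo_object C A \<and> gwo_object C B \<and>
        derived_actions C B A (xdot X) (xstar X) \<and>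
        \<alpha> \<in> gwo_hom C A B \<and>
        (\<forall>b \<in> carrier B. \<forall>a \<in> carrier A.
           \<alpha> (xdot X b a) = b \<otimes>\<^bsub>B\<^esub> \<alpha> a \<otimes>\<^bsub>B\<^esub> inv\<^bsub>B\<^esub> b) \<and>
        (\<forall>a \<in> carrier A. \<forall>a' \<in> carrier A.
           xdot X (\<alpha> a) a' = a \<otimes>\<^bsub>A\<^esub> a' \<otimes>\<^bsub>A\<^esub> inv\<^bsub>A\<^esub> a) \<and>
        (\<forall>f \<in> binops C. \<forall>a \<in> carrier A. \<forall>a' \<in> carrier A.
           xstar X f (\<alpha> a) a' = binop A f a a') \<and>
        (\<forall>f \<in> binops C. \<forall>b \<in> carrier B. \<forall>a \<in> carrier A.
           \<alpha> (xstar X f b a) = binop B f b (\<alpha> a) \<and>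
           \<alpha> (xstar X (opp C f) b a) = binop B f (\<alpha> a) b))"

definition subcrossed_module ::
  "('u, 'o) gwo_category \<Rightarrow> ('a, 'b, 'u, 'o) xmod \<Rightarrow> ('a, 'b, 'u, 'o) xmod \<Rightarrow> bool" where
  "subcrossed_module C Y X \<longleftrightarrow>
     crossed_module C Y \<and> crossed_module C X \<and>
     gwo_subobject C (xdom Y) (xdom X) \<and>
     gwo_subobject C (xcod Y) (xcod X) \<and>
     (\<forall>s \<in> carrier (xdom Y). xmap Y s = xmap X s) \<and>
     (\<forall>t \<in> carrier (xcod Y). \<forall>s \<in> carrier (xdom Y). xdot Y t s = xdot X t s) \<and>
     (\<forall>f \<in> binops C. \<forall>t \<in> carrier (xcod Y). \<forall>s \<in> carrier (xdom Y).
        xstar Y f t s = xstar X f t s)"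

definition normal_subcrossed_module ::
  "('u, 'o) gwo_category \<Rightarrow> ('a, 'b, 'u, 'o) xmod \<Rightarrow> ('a, 'b, 'u, 'o) xmod \<Rightarrow> bool" where
  "normal_subcrossed_module C Y X \<longleftrightarrow>
     subcrossed_module C Y X \<and>
     (let A = xdom X; B = xcod X; S = xdom Y; T = xcod Y in
        gwo_ideal C T B \<and>
        (\<forall>b \<in> carrier B. \<forall>s \<in> carrier S. xdot X b s \<in> carrier S) \<and>
        (\<forall>t \<in> carrier T. \<forall>a \<in> carrier A. xdot X t a \<otimes>\<^bsub>A\<^esub> inv\<^bsub>A\<^esub> a \<in> carrier S) \<and>
        (\<forall>f \<in> binops C. \<forall>b \<in> carrier B. \<forall>s \<in> carrier S. xstar X f b s \<in> carrier S) \<and>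
        (\<forall>f \<in> binops C. \<forall>t \<in> carrier T. \<forall>a \<in> carrier A. xstar X f t a \<in> carrier S))"


section \<open>Cat$^1$-groups with operations\<close>

record ('a, 'u, 'o) cat1 =
  cgrp :: "('a, 'u, 'o) gwo"
  csrc :: "'a \<Rightarrow> 'a"
  ctgt :: "'a \<Rightarrow> 'a"

definition cat1_group ::
  "('u, 'o) gwo_category \<Rightarrow> ('a, 'u, 'o) cat1 \<Rightarrow> bool" where
  "cat1_group C Q \<longleftrightarrow>
     (let G = cgrp Q; s = csrc Q; t = ctgt Q in
        gwo_object C G \<and> s \<in> gwo_hom C G G \<and> t \<in> gwo_hom C G G \<and>
        (\<forall>x \<in> carrier G. s (t x) = t x) \<and>
        (\<forall>x \<in> carrier G. t (s x) = s x) \<and>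
        (\<forall>x \<in> kernel G G s. \<forall>y \<in> kernel G G t. x \<otimes>\<^bsub>G\<^esub> y = y \<otimes>\<^bsub>G\<^esub> x) \<and>
        (\<forall>f \<in> binops C. \<forall>x \<in> kernel G G s. \<forall>y \<in> kernel G G t. binop G f x y = \<one>\<^bsub>G\<^esub>))"

definition normal_subcat1_group ::
  "('u, 'o) gwo_category \<Rightarrow> ('a, 'u, 'o) cat1 \<Rightarrow> ('a, 'u, 'o) cat1 \<Rightarrow> bool" where
  "normal_subcat1_group C P Q \<longleftrightarrow>
     cat1_group C P \<and> cat1_group C Q \<and>
     gwo_ideal C (cgrp P) (cgrp Q) \<and>
     (\<forall>x \<in> carrier (cgrp P). csrc P x = csrc Q x) \<and>
     (\<forall>x \<in> carrier (cgrp P). ctgt P x = ctgt Q x)"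

definition xmod_of_cat1 :: "('a, 'u, 'o) cat1 \<Rightarrow> ('a, 'a, 'u, 'o) xmod" where
  "xmod_of_cat1 Q =
     (let G = cgrp Q; s = csrc Q; t = ctgt Q in
        \<lparr>xdom = G\<lparr>carrier := kernel G G s\<rparr>,
         xcod = G\<lparr>carrier := s ` carrier G\<rparr>,
         xmap = restrict t (kernel G G s),
         xdot = (\<lambda>b a. b \<otimes>\<^bsub>G\<^esub> a \<otimes>\<^bsub>G\<^esub> inv\<^bsub>G\<^esub> b),
         xstar = (\<lambda>f b a. binop G f b a)\<rparr>)"


section \<open>Adequacy of the encoding\<close>

lemma object_closed:
  assumes "gwo_object C G"
  shows "\<one>\<^bsub>G\<^esub> \<in> carrier G"
    and "x \<in> carrier G \<Longrightarrow> inv\<^bsub>G\<^esub> x \<in> carrier G"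
    and "x \<in> carrier G \<Longrightarrow> y \<in> carrier G \<Longrightarrow> x \<otimes>\<^bsub>G\<^esub> y \<in> carrier G"
    and "w \<in> unops C \<Longrightarrow> x \<in> carrier G \<Longrightarrow> unop G w x \<in> carrier G"
    and "f \<in> binops C \<Longrightarrow> x \<in> carrier G \<Longrightarrow> y \<in> carrier G \<Longrightarrow> binop G f x y \<in> carrier G"
  using assms by (auto simp: gwo_object_def)

lemma object_ident:
  assumes "gwo_object C G" "(l, r) \<in> idents C" "range \<rho> \<subseteq> carrier G"
  shows "term_val G \<rho> l = term_val G \<rho> r"
  using assms by (auto simp: gwo_object_def)

lemma object_group:
  fixes G :: "('a, 'u, 'o) gwo"
  assumes C: "gwo_category C" and G: "gwo_object C G"
  shows "group G"
proof -
  have sub: "group_laws \<subseteq> idents C" using C by (simp add: gwo_category_def)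
  have law: "term_val G \<rho> l = term_val G \<rho> r"
    if "(l, r) \<in> group_laws" "range \<rho> \<subseteq> carrier G" for l r \<rho>
    using object_ident[OF G] sub that by blast
  define e where "e x y z = (\<lambda>n::nat. if n = 0 then x else if n = 1 then y else z)" for x y z :: 'a
  have e: "range (e x y z) \<subseteq> carrier G"
    if "x \<in> carrier G" "y \<in> carrier G" "z \<in> carrier G" for x y z
    using that by (auto simp: e_def)
  show ?thesis
  proof (rule groupI)
    fix x y z assume xyz: "x \<in> carrier G" "y \<in> carrier G" "z \<in> carrier G"
    show "x \<otimes>\<^bsub>G\<^esub> y \<otimes>\<^bsub>G\<^esub> z = x \<otimes>\<^bsub>G\<^esub> (y \<otimes>\<^bsub>G\<^esub> z)"
      using law[OF _ e[OF xyz], of "Plus (Plus (Var 0) (Var 1)) (Var 2)"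
          "Plus (Var 0) (Plus (Var 1) (Var 2))"]
      by (simp add: group_laws_def e_def)
  next
    fix x assume x: "x \<in> carrier G"
    show "\<one>\<^bsub>G\<^esub> \<otimes>\<^bsub>G\<^esub> x = x"
      using law[OF _ e[OF x x x], of "Plus Zero (Var 0)" "Var 0"]
      by (simp add: group_laws_def e_def)
    have "inv\<^bsub>G\<^esub> x \<otimes>\<^bsub>G\<^esub> x = \<one>\<^bsub>G\<^esub>"
      using law[OF _ e[OF x x x], of "Plus (Neg (Var 0)) (Var 0)" "Zero"]
      by (simp add: group_laws_def e_def)
    then show "\<exists>y\<in>carrier G. y \<otimes>\<^bsub>G\<^esub> x = \<one>\<^bsub>G\<^esub>"
      using object_closed(2)[OF G x] by blast
  qed (use object_closed[OF G] in auto)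
qed

definition transport :: "('e \<Rightarrow> 'c) \<Rightarrow> ('e, 'u, 'o) gwo \<Rightarrow> ('c, 'u, 'o) gwo" where
  "transport \<phi> E =
     (let \<psi> = inv_into (carrier E) \<phi> in
        \<lparr>carrier = \<phi> ` carrier E,
         mult = (\<lambda>x y. \<phi> (\<psi> x \<otimes>\<^bsub>E\<^esub> \<psi> y)),
         one = \<phi> \<one>\<^bsub>E\<^esub>,
         unop = (\<lambda>w x. \<phi> (unop E w (\<psi> x))),
         binop = (\<lambda>f x y. \<phi> (binop E f (\<psi> x) (\<psi> y)))\<rparr>)"

lemma transport_simps [simp]:
  "carrier (transport \<phi> E) = \<phi> ` carrier E"
  "one (transport \<phi> E) = \<phi> \<one>\<^bsub>E\<^esub>"
  by (simp_all add: transport_def Let_def)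

lemma transport_ops:
  assumes "inj_on \<phi> (carrier E)" "x \<in> carrier E"
  shows "y \<in> carrier E \<Longrightarrow> \<phi> x \<otimes>\<^bsub>transport \<phi> E\<^esub> \<phi> y = \<phi> (x \<otimes>\<^bsub>E\<^esub> y)"
    and "unop (transport \<phi> E) w (\<phi> x) = \<phi> (unop E w x)"
    and "y \<in> carrier E \<Longrightarrow> binop (transport \<phi> E) f (\<phi> x) (\<phi> y) = \<phi> (binop E f x y)"
  using assms by (simp_all add: transport_def Let_def)

lemma transport_inv:
  assumes E: "group E" and inj: "inj_on \<phi> (carrier E)"
  shows "group (transport \<phi> E)"
    and "x \<in> carrier E \<Longrightarrow> inv\<^bsub>transport \<phi> E\<^esub> (\<phi> x) = \<phi> (inv\<^bsub>E\<^esub> x)"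
proof -
  interpret group E by (fact E)
  show T: "group (transport \<phi> E)"
  proof (rule groupI)
    fix x assume "x \<in> carrier (transport \<phi> E)"
    then obtain u where u: "u \<in> carrier E" "x = \<phi> u" by auto
    then show "\<exists>y\<in>carrier (transport \<phi> E). y \<otimes>\<^bsub>transport \<phi> E\<^esub> x = \<one>\<^bsub>transport \<phi> E\<^esub>"
      by (intro bexI[of _ "\<phi> (inv\<^bsub>E\<^esub> u)"]) (auto simp: transport_ops[OF inj])
  qed (auto simp: transport_ops[OF inj] m_assoc)
  assume x: "x \<in> carrier E"
  show "inv\<^bsub>transport \<phi> E\<^esub> (\<phi> x) = \<phi> (inv\<^bsub>E\<^esub> x)"
    by (rule group.inv_equality[OF T]) (use x in \<open>auto simp: transport_ops[OF inj]\<close>)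
qed

lemma term_val_closed:
  assumes "gwo_object C G" "range \<rho> \<subseteq> carrier G" "wf_term C t"
  shows "term_val G \<rho> t \<in> carrier G"
  using assms(3)
  by (induction t) (use assms(2) in \<open>auto simp: wf_term_def object_closed[OF assms(1)]\<close>)

lemma transport_object:
  assumes C: "gwo_category C" and E: "gwo_object C E" and inj: "inj_on \<phi> (carrier E)"
  shows "gwo_object C (transport \<phi> E)"
proof -
  note gE = object_group[OF C E]
  have val: "term_val (transport \<phi> E) \<rho> t = \<phi> (term_val E (\<lambda>n. inv_into (carrier E) \<phi> (\<rho> n)) t)"
    if r: "range \<rho> \<subseteq> \<phi> ` carrier E" and "wf_term C t" for \<rho> t
    using that(2)
  proof (induction t)
    case (Var n)
    have "\<rho> n \<in> \<phi> ` carrier E" using r by auto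
    then show ?case by (simp add: f_inv_into_f)
  next
    case Zero
    then show ?case by simp
  next
    case (Neg t)
    have "range (\<lambda>n. inv_into (carrier E) \<phi> (\<rho> n)) \<subseteq> carrier E"
      using r by (auto intro!: inv_into_into)
    with Neg term_val_closed[OF E this, of t] show ?case
      by (simp add: wf_term_def transport_inv[OF gE inj])
  next
    case (Plus t u)
    have "range (\<lambda>n. inv_into (carrier E) \<phi> (\<rho> n)) \<subseteq> carrier E"
      using r by (auto intro!: inv_into_into)
    with Plus term_val_closed[OF E this, of t] term_val_closed[OF E this, of u] show ?case
      by (simp add: wf_term_def transport_ops[OF inj])
  next
    case (UnOp w t)
    have "range (\<lambda>n. inv_into (carrier E) \<phi> (\<rho> n)) \<subseteq> carrier E"
      using r by (auto intro!: inv_into_into)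
    with UnOp term_val_closed[OF E this, of t] show ?case
      by (simp add: wf_term_def transport_ops[OF inj])
  next
    case (BinOp f t u)
    have "range (\<lambda>n. inv_into (carrier E) \<phi> (\<rho> n)) \<subseteq> carrier E"
      using r by (auto intro!: inv_into_into)
    with BinOp term_val_closed[OF E this, of t] term_val_closed[OF E this, of u] show ?case
      by (simp add: wf_term_def transport_ops[OF inj])
  qed
  have "term_val (transport \<phi> E) \<rho> l = term_val (transport \<phi> E) \<rho> r"
    if lr: "(l, r) \<in> idents C" and r: "range \<rho> \<subseteq> \<phi> ` carrier E" for l r \<rho>
  proof -
    have "wf_term C l" "wf_term C r" using C lr by (auto simp: gwo_category_def)
    moreover have "range (\<lambda>n. inv_into (carrier E) \<phi> (\<rho> n)) \<subseteq> carrier E"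
      using r by (auto intro!: inv_into_into)
    ultimately show ?thesis using val[OF r] object_ident[OF E lr] by simp
  qed
  then show ?thesis
    using object_closed[OF E]
    by (auto simp: gwo_object_def transport_ops[OF inj] transport_inv[OF gE inj])
qed

lemma derived_actionsI:
  fixes E :: "('e, 'u, 'o) gwo" and A :: "('a, 'u, 'o) gwo" and B :: "('b, 'u, 'o) gwo"
  assumes C: "gwo_category C"
    and ext: "split_extension C A E B i p s"
    and act: "induces_action C A E B i s dot star"
  shows "derived_actions C B A dot star"
proof -
  note oA = ext[unfolded split_extension_def, THEN conjunct1]
  have oE: "gwo_object C E" and oB: "gwo_object C B"
    and i: "i \<in> gwo_hom C A E" and p: "p \<in> gwo_hom C E B" and s: "s \<in> gwo_hom C B E"
    and inji: "inj_on i (carrier A)" and ker: "i ` carrier A = kernel E B p"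
    and surj: "p ` carrier E = carrier B" and ps: "\<And>b. b \<in> carrier B \<Longrightarrow> p (s b) = b"
    using ext by (auto simp: split_extension_def)
  have gE: "group E" and gB: "group B" using object_group[OF C] oE oB by blast+
  interpret E: group E by (fact gE)
  interpret P: group_hom E B p
    using p gE gB by (auto simp: group_hom_def group_hom_axioms_def gwo_hom_def)
  have ic: "i a \<in> carrier E" if "a \<in> carrier A" for a
    using i that by (auto simp: gwo_hom_def hom_def)
  have sc: "s b \<in> carrier E" if "b \<in> carrier B" for b
    using s that by (auto simp: gwo_hom_def hom_def)
  define \<phi> where "\<phi> e = (inv_into (carrier A) i (e \<otimes>\<^bsub>E\<^esub> inv\<^bsub>E\<^esub> (s (p e))), p e)" for e
  have inj: "inj_on \<phi> (carrier E)"
  proof (rule inj_onI)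
    fix x y assume x: "x \<in> carrier E" and y: "y \<in> carrier E" and eq: "\<phi> x = \<phi> y"
    have pe: "p x = p y" using eq by (simp add: \<phi>_def)
    have mem: "e \<otimes>\<^bsub>E\<^esub> inv\<^bsub>E\<^esub> (s (p e)) \<in> i ` carrier A" if "e \<in> carrier E" for e
      unfolding ker kernel_def using that by (simp add: sc ps P.hom_inv)
    have "x \<otimes>\<^bsub>E\<^esub> inv\<^bsub>E\<^esub> (s (p x)) = y \<otimes>\<^bsub>E\<^esub> inv\<^bsub>E\<^esub> (s (p y))"
      using eq mem[OF x] mem[OF y] unfolding \<phi>_def by (metis Pair_inject f_inv_into_f)
    then show "x = y" using x y pe sc by simp
  qed
  define E' where "E' = transport \<phi> E"
  define \<psi> where "\<psi> = inv_into (carrier E) \<phi>"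
  have \<psi>: "\<psi> (\<phi> x) = x" if "x \<in> carrier E" for x
    using that inj by (simp add: \<psi>_def)
  have cE': "carrier E' = \<phi> ` carrier E" by (simp add: E'_def)
  have ops: "x \<in> carrier E \<Longrightarrow> y \<in> carrier E \<Longrightarrow> \<phi> x \<otimes>\<^bsub>E'\<^esub> \<phi> y = \<phi> (x \<otimes>\<^bsub>E\<^esub> y)"
    "x \<in> carrier E \<Longrightarrow> unop E' w (\<phi> x) = \<phi> (unop E w x)"
    "x \<in> carrier E \<Longrightarrow> y \<in> carrier E \<Longrightarrow> binop E' f (\<phi> x) (\<phi> y) = \<phi> (binop E f x y)"
    "x \<in> carrier E \<Longrightarrow> inv\<^bsub>E'\<^esub> (\<phi> x) = \<phi> (inv\<^bsub>E\<^esub> x)" for x y w f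
    by (simp_all add: E'_def transport_ops[OF inj] transport_inv[OF gE inj])
  have "split_extension C A E' B (\<phi> \<circ> i) (p \<circ> \<psi>) (\<phi> \<circ> s)"
    unfolding split_extension_def
  proof (intro conjI)
    show "gwo_object C E'" unfolding E'_def by (rule transport_object[OF C oE inj])
    show "\<phi> \<circ> i \<in> gwo_hom C A E'"
      using i ic by (auto simp: gwo_hom_def hom_def cE' ops)
    show "\<phi> \<circ> s \<in> gwo_hom C B E'"
      using s sc by (auto simp: gwo_hom_def hom_def cE' ops)
    show "p \<circ> \<psi> \<in> gwo_hom C E' B"
      using p object_closed[OF oE]
      by (auto simp: gwo_hom_def hom_def cE' ops \<psi>)
    show "inj_on (\<phi> \<circ> i) (carrier A)"
      using inji inj ic by (auto intro!: comp_inj_on simp: inj_on_def)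
    have "kernel E' B (p \<circ> \<psi>) = \<phi> ` kernel E B p"
      by (auto simp: kernel_def cE' \<psi>)
    then show "(\<phi> \<circ> i) ` carrier A = kernel E' B (p \<circ> \<psi>)"
      by (metis image_comp ker)
    show "(p \<circ> \<psi>) ` carrier E' = carrier B"
      unfolding surj[symmetric] cE' by (auto simp: \<psi> image_iff)
    show "\<forall>b\<in>carrier B. (p \<circ> \<psi>) ((\<phi> \<circ> s) b) = b"
      by (simp add: sc \<psi> ps)
  qed (fact oA oB)+
  moreover have "induces_action C A E' B (\<phi> \<circ> i) (\<phi> \<circ> s) dot star"
    using act by (auto simp: induces_action_def ops ic sc)
  ultimately show ?thesis unfolding derived_actions_def E'_def by blast
qed

end

theory Submission
  imports Defs
begin

text \<open>
  Everything takes place inside \<open>G\<close>. Let \<open>A = ker s\<close> and \<open>B = Im s\<close>. Since \<open>st = t\<close> and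
  \<open>ts = s\<close>, both \<open>s\<close> and \<open>t\<close> are retractions of \<open>G\<close> onto \<open>B\<close>, so that \<open>s\<close> together with the
  inclusion of \<open>B\<close> splits \<open>0 \<rightarrow> A \<rightarrow> G \<rightarrow> B \<rightarrow> 0\<close>: the actions computed in \<open>G\<close> are derived actions.
  Equivariance of \<open>t\<close> holds because \<open>t\<close> is a morphism that fixes \<open>B\<close>. The remaining crossed
  module axioms compare \<open>t a\<close> with \<open>a\<close>; the difference \<open>- a + t a\<close> lies in \<open>ker t\<close>, which by the
  definition of a cat1-group commutes with \<open>ker s\<close> and has zero \<open>\<star>\<close>-products with it. This is
  \<open>crossed_module_of_cat1_group\<close>, which applies to \<open>N\<close> as well as to \<open>G\<close>.

  For normality, \<open>s\<^sub>N\<close> being a restriction of \<open>s\<^sub>G\<close> gives \<open>S = N \<inter> A\<close> and \<open>T = N \<inter> B\<close>. As \<open>N\<close> and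
  the kernel \<open>A\<close> are ideals of \<open>G\<close> (\<open>kernel_ideal\<close>), each closure condition splits into a
  membership in \<open>N\<close> and one in \<open>A\<close> or \<open>B\<close>, and both follow from absorption by an ideal or from
  closure of a subobject.
\<close>

section \<open>Consequences of the identities\<close>

lemma object_binop_opp:
  fixes G :: "('a, 'u, 'o) gwo"
  assumes C: "gwo_category C" and G: "gwo_object C G" and f: "f \<in> binops C"
    and x: "x \<in> carrier G" and y: "y \<in> carrier G"
  shows "binop G (opp C f) x y = binop G f y x"
proof -
  have id: "(BinOp (opp C f) (Var 0) (Var 1), BinOp f (Var 1) (Var 0)) \<in> idents C"
    using C f by (auto simp: gwo_category_def)
  have "range (\<lambda>n::nat. if n = 0 then x else y) \<subseteq> carrier G" using x y by auto
  from object_ident[OF G id this] show ?thesis by simp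
qed

lemma object_binop_distrib_right:
  fixes G :: "('a, 'u, 'o) gwo"
  assumes C: "gwo_category C" and G: "gwo_object C G" and f: "f \<in> binops C"
    and x: "x \<in> carrier G" and y: "y \<in> carrier G" and z: "z \<in> carrier G"
  shows "binop G f x (y \<otimes>\<^bsub>G\<^esub> z) = binop G f x y \<otimes>\<^bsub>G\<^esub> binop G f x z"
proof -
  have id: "(BinOp f (Var 0) (Plus (Var 1) (Var 2)),
      Plus (BinOp f (Var 0) (Var 1)) (BinOp f (Var 0) (Var 2))) \<in> idents C"
    using C f by (auto simp: gwo_category_def)
  have "range (\<lambda>n::nat. if n = 0 then x else if n = 1 then y else z) \<subseteq> carrier G"
    using x y z by auto
  from object_ident[OF G id this] show ?thesis by simp
qed

text \<open>
  The axioms on the identities give additivity in the second argument; passing to the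
  opposite operation moves it to the first argument.
\<close>

lemma object_binop_distrib_left:
  fixes G :: "('a, 'u, 'o) gwo"
  assumes C: "gwo_category C" and G: "gwo_object C G" and f: "f \<in> binops C"
    and x: "x \<in> carrier G" and y: "y \<in> carrier G" and z: "z \<in> carrier G"
  shows "binop G f (x \<otimes>\<^bsub>G\<^esub> y) z = binop G f x z \<otimes>\<^bsub>G\<^esub> binop G f y z"
proof -
  have "opp C f \<in> binops C" using C f by (auto simp: gwo_category_def)
  from object_binop_distrib_right[OF C G this z x y] show ?thesis
    using x y z object_closed(3)[OF G x y] by (simp add: object_binop_opp[OF C G f])
qed

lemma object_unop_one:
  fixes G :: "('a, 'u, 'o) gwo"
  assumes C: "gwo_category C" and G: "gwo_object C G" and w: "w \<in> unops C"
  shows "unop G w \<one>\<^bsub>G\<^esub> = \<one>\<^bsub>G\<^esub>"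
proof -
  interpret group G by (rule object_group[OF C G])
  have id: "(UnOp w (Plus (Var 0) (Var 1)), Plus (UnOp w (Var 0)) (UnOp w (Var 1))) \<in> idents C"
    using C w by (auto simp: gwo_category_def)
  have "range (\<lambda>n::nat. \<one>\<^bsub>G\<^esub>) \<subseteq> carrier G" by auto
  from object_ident[OF G id this]
  have "unop G w \<one>\<^bsub>G\<^esub> = unop G w \<one>\<^bsub>G\<^esub> \<otimes>\<^bsub>G\<^esub> unop G w \<one>\<^bsub>G\<^esub>" by simp
  then show ?thesis using object_closed(4)[OF G w one_closed] l_cancel_one' by metis
qed

lemma object_binop_one:
  fixes G :: "('a, 'u, 'o) gwo"
  assumes C: "gwo_category C" and G: "gwo_object C G" and f: "f \<in> binops C"
    and x: "x \<in> carrier G"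
  shows "binop G f x \<one>\<^bsub>G\<^esub> = \<one>\<^bsub>G\<^esub>" and "binop G f \<one>\<^bsub>G\<^esub> x = \<one>\<^bsub>G\<^esub>"
proof -
  interpret group G by (rule object_group[OF C G])
  have *: "binop G g x \<one>\<^bsub>G\<^esub> = \<one>\<^bsub>G\<^esub>" if g: "g \<in> binops C" for g
    using object_binop_distrib_right[OF C G g x one_closed one_closed]
      object_closed(5)[OF G g x one_closed] l_cancel_one' by (metis l_one one_closed)
  show "binop G f x \<one>\<^bsub>G\<^esub> = \<one>\<^bsub>G\<^esub>" by (rule *[OF f])
  have "opp C f \<in> binops C" using C f by (auto simp: gwo_category_def)
  from *[OF this] show "binop G f \<one>\<^bsub>G\<^esub> x = \<one>\<^bsub>G\<^esub>"
    using object_binop_opp[OF C G f x one_closed] by simp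
qed


section \<open>Subobjects, kernels and images\<close>

text \<open>
  Identities are universally quantified, so they pass to subsets closed under the operations:
  terms take the same value in the subobject as in the whole object.
\<close>

lemma subobject_object:
  fixes G H :: "('a, 'u, 'o) gwo"
  assumes C: "gwo_category C" and G: "gwo_object C G" and H: "gwo_subobject C H G"
  shows "gwo_object C H"
proof -
  have sg: "subgroup (carrier H) G" using H by (simp add: gwo_subobject_def)
  have cl: "\<one>\<^bsub>H\<^esub> \<in> carrier H"
    "x \<in> carrier H \<Longrightarrow> inv\<^bsub>H\<^esub> x \<in> carrier H"
    "x \<in> carrier H \<Longrightarrow> y \<in> carrier H \<Longrightarrow> x \<otimes>\<^bsub>H\<^esub> y \<in> carrier H"
    "w \<in> unops C \<Longrightarrow> x \<in> carrier H \<Longrightarrow> unop H w x \<in> carrier H"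
    "f \<in> binops C \<Longrightarrow> x \<in> carrier H \<Longrightarrow> y \<in> carrier H \<Longrightarrow> binop H f x y \<in> carrier H"
    for x y w f
    using H subgroup.one_closed[OF sg] subgroup.m_inv_closed[OF sg] subgroup.m_closed[OF sg]
    by (auto simp: gwo_subobject_def)
  have val: "term_val H \<rho> t \<in> carrier H \<and> term_val H \<rho> t = term_val G \<rho> t"
    if r: "range \<rho> \<subseteq> carrier H" and t: "wf_term C t" for \<rho> t
    using t
  proof (induction t)
    case (Var n)
    then show ?case using r by auto
  next
    case Zero
    then show ?case using H cl by (simp add: gwo_subobject_def)
  next
    case (Neg t)
    then show ?case using H cl(2) by (auto simp: gwo_subobject_def wf_term_def)
  next
    case (Plus t u)
    then show ?case using H cl(3) by (auto simp: gwo_subobject_def wf_term_def)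
  next
    case (UnOp w t)
    then show ?case using H cl(4) by (auto simp: gwo_subobject_def wf_term_def)
  next
    case (BinOp f t u)
    then show ?case using H cl(5) by (auto simp: gwo_subobject_def wf_term_def)
  qed
  have "term_val H \<rho> l = term_val H \<rho> r"
    if lr: "(l, r) \<in> idents C" and rg: "range \<rho> \<subseteq> carrier H" for l r \<rho>
  proof -
    have "wf_term C l" "wf_term C r" using C lr by (auto simp: gwo_category_def)
    moreover have "range \<rho> \<subseteq> carrier G" using rg subgroup.subset[OF sg] by blast
    ultimately show ?thesis using val[OF rg] object_ident[OF G lr] by simp
  qed
  then show ?thesis using cl by (auto simp: gwo_object_def)
qed

lemma restrict_subobject:
  fixes G :: "('a, 'u, 'o) gwo"
  assumes C: "gwo_category C" and G: "gwo_object C G" and K: "subgroup K G"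
    and "\<And>w x. w \<in> unops C \<Longrightarrow> x \<in> K \<Longrightarrow> unop G w x \<in> K"
    and "\<And>f x y. f \<in> binops C \<Longrightarrow> x \<in> K \<Longrightarrow> y \<in> K \<Longrightarrow> binop G f x y \<in> K"
  shows "gwo_subobject C (G\<lparr>carrier := K\<rparr>) G"
  using assms group.m_inv_consistent[OF object_group[OF C G] K]
  by (auto simp: gwo_subobject_def)

lemma subobject_trans:
  fixes G H K :: "('a, 'u, 'o) gwo"
  assumes C: "gwo_category C" and G: "gwo_object C G"
    and K: "gwo_subobject C K H" and H: "gwo_subobject C H G"
  shows "gwo_subobject C K G"
proof -
  interpret G: group G by (rule object_group[OF C G])
  have KH: "subgroup (carrier K) H" and HG: "subgroup (carrier H) G"
    using K H by (simp_all add: gwo_subobject_def)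
  have sub: "carrier K \<subseteq> carrier H" "carrier H \<subseteq> carrier G"
    using subgroup.subset KH HG by blast+
  have "subgroup (carrier K) G"
  proof (rule G.subgroupI)
    show "carrier K \<subseteq> carrier G" using sub by blast
    show "carrier K \<noteq> {}" using subgroup.one_closed[OF KH] by blast
  next
    fix a assume "a \<in> carrier K"
    then show "inv\<^bsub>G\<^esub> a \<in> carrier K"
      using H sub subgroup.m_inv_closed[OF KH, of a] by (auto simp: gwo_subobject_def)
  next
    fix a b assume "a \<in> carrier K" "b \<in> carrier K"
    then show "a \<otimes>\<^bsub>G\<^esub> b \<in> carrier K"
      using H sub subgroup.m_closed[OF KH, of a b] by (auto simp: gwo_subobject_def subset_iff)
  qed
  then show ?thesis using H K sub(1) by (auto simp: gwo_subobject_def subset_iff)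
qed

lemma subobject_mono:
  fixes G H K :: "('a, 'u, 'o) gwo"
  assumes C: "gwo_category C" and G: "gwo_object C G"
    and K: "gwo_subobject C K G" and H: "gwo_subobject C H G"
    and sub: "carrier K \<subseteq> carrier H"
  shows "gwo_subobject C K H"
proof -
  interpret H: group H by (rule object_group[OF C subobject_object[OF C G H]])
  have KG: "subgroup (carrier K) G" using K by (simp add: gwo_subobject_def)
  have "subgroup (carrier K) H"
  proof (rule H.subgroupI)
    show "carrier K \<subseteq> carrier H" by (rule sub)
    show "carrier K \<noteq> {}" using subgroup.one_closed[OF KG] by blast
  next
    fix a assume "a \<in> carrier K"
    then show "inv\<^bsub>H\<^esub> a \<in> carrier K"
      using H sub subgroup.m_inv_closed[OF KG, of a] by (auto simp: gwo_subobject_def)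
  next
    fix a b assume "a \<in> carrier K" "b \<in> carrier K"
    then show "a \<otimes>\<^bsub>H\<^esub> b \<in> carrier K"
      using H sub subgroup.m_closed[OF KG, of a b] by (auto simp: gwo_subobject_def subset_iff)
  qed
  then show ?thesis using H K sub by (auto simp: gwo_subobject_def subset_iff)
qed

lemma gwo_hom_group_hom:
  assumes "gwo_category C" "gwo_object C G" "gwo_object C H" "h \<in> gwo_hom C G H"
  shows "group_hom G H h"
  using assms object_group[OF assms(1,2)] object_group[OF assms(1,3)]
  by (auto simp: group_hom_def group_hom_axioms_def gwo_hom_def)

text \<open>
  Closure under the operations comes from \<open>\<omega>(0) = 0\<close> and \<open>a \<star> 0 = 0\<close>, both consequences of
  additivity.
\<close>

lemma kernel_ideal:
  fixes G :: "('a, 'u, 'o) gwo" and H :: "('b, 'u, 'o) gwo"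
  assumes C: "gwo_category C" and G: "gwo_object C G" and H: "gwo_object C H"
    and h: "h \<in> gwo_hom C G H"
  shows "gwo_ideal C (G\<lparr>carrier := kernel G H h\<rparr>) G"
proof -
  interpret h: group_hom G H h by (rule gwo_hom_group_hom[OF C G H h])
  have un: "unop G w x \<in> kernel G H h" if "w \<in> unops C" "x \<in> kernel G H h" for w x
    using that h object_unop_one[OF C H] object_closed(4)[OF G]
    by (auto simp: kernel_def gwo_hom_def)
  have bin: "binop G f a x \<in> kernel G H h"
    if "f \<in> binops C" "a \<in> carrier G" "x \<in> kernel G H h" for f a x
    using that h object_binop_one(1)[OF C H] object_closed(5)[OF G]
    by (auto simp: kernel_def gwo_hom_def)
  have "gwo_subobject C (G\<lparr>carrier := kernel G H h\<rparr>) G"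
    using un bin by (intro restrict_subobject[OF C G h.subgroup_kernel]) (auto simp: kernel_def)
  then show ?thesis using bin h.normal_kernel by (auto simp: gwo_ideal_def)
qed

lemma image_subobject:
  fixes G :: "('a, 'u, 'o) gwo" and H :: "('b, 'u, 'o) gwo"
  assumes C: "gwo_category C" and G: "gwo_object C G" and H: "gwo_object C H"
    and h: "h \<in> gwo_hom C G H"
  shows "gwo_subobject C (H\<lparr>carrier := h ` carrier G\<rparr>) H"
proof (rule restrict_subobject[OF C H])
  interpret h: group_hom G H h by (rule gwo_hom_group_hom[OF C G H h])
  show "subgroup (h ` carrier G) H" by (rule h.img_is_subgroup)
next
  fix w y assume w: "w \<in> unops C" and "y \<in> h ` carrier G"
  then obtain x where x: "x \<in> carrier G" "y = h x" by blast
  then have "unop H w y = h (unop G w x)" using h w by (simp add: gwo_hom_def)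
  then show "unop H w y \<in> h ` carrier G" using object_closed(4)[OF G w] x by blast
next
  fix f y y' assume f: "f \<in> binops C" and "y \<in> h ` carrier G" "y' \<in> h ` carrier G"
  then obtain x x' where x: "x \<in> carrier G" "y = h x" "x' \<in> carrier G" "y' = h x'" by blast
  then have "binop H f y y' = h (binop G f x x')" using h f by (simp add: gwo_hom_def)
  then show "binop H f y y' \<in> h ` carrier G" using object_closed(5)[OF G f] x by blast
qed


section \<open>The crossed module of a cat1-group\<close>

text \<open>
  The two relations combine to \<open>ss = s(ts) = (st)s = ts = s\<close>, and
  symmetrically for \<open>t\<close>.
\<close>

lemma cat1_group_retraction:
  fixes Q :: "('a, 'u, 'o) cat1"
  assumes Q: "cat1_group C Q" and x: "x \<in> carrier (cgrp Q)"
  shows "csrc Q (csrc Q x) = csrc Q x" and "ctgt Q (ctgt Q x) = ctgt Q x"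
proof -
  have st: "csrc Q (ctgt Q y) = ctgt Q y" "ctgt Q (csrc Q y) = csrc Q y"
    and cl: "csrc Q y \<in> carrier (cgrp Q)" "ctgt Q y \<in> carrier (cgrp Q)"
    if "y \<in> carrier (cgrp Q)" for y
    using Q that by (auto simp: cat1_group_def Let_def gwo_hom_def hom_def)
  show "csrc Q (csrc Q x) = csrc Q x" using st cl x by metis
  show "ctgt Q (ctgt Q x) = ctgt Q x" using st cl x by metis
qed

text \<open>
  The derived actions come from the split extension whose middle object is \<open>G\<close> itself. The two
  Peiffer-type axioms are where the commutation and annihilation conditions between \<open>ker s\<close> and
  \<open>ker t\<close> enter.
\<close>

lemma crossed_module_of_cat1_group:
  fixes Q :: "('a, 'u, 'o) cat1"
  assumes C: "gwo_category C" and Q: "cat1_group C Q"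
  shows "crossed_module C (xmod_of_cat1 Q)"
proof -
  define G where "G = cgrp Q"
  define s where "s = csrc Q"
  define t where "t = ctgt Q"
  have oG: "gwo_object C G" and s: "s \<in> gwo_hom C G G" and t: "t \<in> gwo_hom C G G"
    and ts: "\<And>x. x \<in> carrier G \<Longrightarrow> t (s x) = s x"
    and st: "\<And>x. x \<in> carrier G \<Longrightarrow> s (t x) = t x"
    and comm: "\<And>x y. x \<in> kernel G G s \<Longrightarrow> y \<in> kernel G G t \<Longrightarrow> x \<otimes>\<^bsub>G\<^esub> y = y \<otimes>\<^bsub>G\<^esub> x"
    and ann: "\<And>f x y. f \<in> binops C \<Longrightarrow> x \<in> kernel G G s \<Longrightarrow> y \<in> kernel G G t \<Longrightarrow>
      binop G f x y = \<one>\<^bsub>G\<^esub>"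
    using Q by (auto simp: cat1_group_def Let_def G_def s_def t_def)
  have ss: "\<And>x. x \<in> carrier G \<Longrightarrow> s (s x) = s x" and tt: "\<And>x. x \<in> carrier G \<Longrightarrow> t (t x) = t x"
    using cat1_group_retraction[OF Q] by (auto simp: G_def s_def t_def)
  interpret s: group_hom G G s by (rule gwo_hom_group_hom[OF C oG oG s])
  interpret t: group_hom G G t by (rule gwo_hom_group_hom[OF C oG oG t])
  define A where "A = G\<lparr>carrier := kernel G G s\<rparr>"
  define B where "B = G\<lparr>carrier := s ` carrier G\<rparr>"
  have idA: "gwo_ideal C A G" unfolding A_def by (rule kernel_ideal[OF C oG oG s])
  then have subA: "gwo_subobject C A G" by (simp add: gwo_ideal_def)
  have subB: "gwo_subobject C B G" unfolding B_def by (rule image_subobject[OF C oG oG s])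
  note oA = subobject_object[OF C oG subA] and oB = subobject_object[OF C oG subB]
  have cA: "carrier A = kernel G G s" and cB: "carrier B = s ` carrier G"
    by (simp_all add: A_def B_def)
  have Ac: "a \<in> carrier G" "s a = \<one>\<^bsub>G\<^esub>" if "a \<in> carrier A" for a
    using that by (auto simp: cA kernel_def)
  have Bc: "b \<in> carrier G" "s b = b" "t b = b" if "b \<in> carrier B" for b
    using that ss ts by (auto simp: cB)
  have invA: "inv\<^bsub>A\<^esub> a = inv\<^bsub>G\<^esub> a" if "a \<in> carrier A" for a
    using subA that by (simp add: gwo_subobject_def)
  have invB: "inv\<^bsub>B\<^esub> b = inv\<^bsub>G\<^esub> b" if "b \<in> carrier B" for b
    using subB that by (simp add: gwo_subobject_def)
  have opsA: "mult A = mult G" "one A = one G" "unop A = unop G" "binop A = binop G"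
    and opsB: "mult B = mult G" "one B = one G" "unop B = unop G" "binop B = binop G"
    by (simp_all add: A_def B_def)
  have tB: "t x \<in> carrier B" if "x \<in> carrier G" for x
    using st[OF that] that unfolding cB by (metis image_eqI t.hom_closed)
  have opp: "opp C f \<in> binops C" if "f \<in> binops C" for f
    using C that by (auto simp: gwo_category_def)
  have dotA: "b \<otimes>\<^bsub>G\<^esub> a \<otimes>\<^bsub>G\<^esub> inv\<^bsub>G\<^esub> b \<in> carrier A" if "b \<in> carrier G" "a \<in> carrier A" for a b
    using that Ac[OF that(2)] by (simp add: cA kernel_def)
  have starA: "binop G f b a \<in> carrier A"
    if "f \<in> binops C" "b \<in> carrier G" "a \<in> carrier A" for f a b
    using idA that by (simp add: gwo_ideal_def)
  \<comment> \<open>\<open>d a\<close> measures how far \<open>t a\<close> is from \<open>a\<close>; it lies in \<open>ker t\<close> because \<open>tt = t\<close>, so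
      conjugation by it fixes \<open>ker s\<close> pointwise and its \<open>\<star>\<close>-products with \<open>ker s\<close> vanish.\<close>
  define d where "d a = inv\<^bsub>G\<^esub> a \<otimes>\<^bsub>G\<^esub> t a" for a
  have d: "d a \<in> kernel G G t" "d a \<in> carrier G" "t a = a \<otimes>\<^bsub>G\<^esub> d a" if "a \<in> carrier G" for a
    using that tt[OF that] by (auto simp: d_def kernel_def simp flip: s.m_assoc)
  have ext: "split_extension C A G B (\<lambda>a. a) s (\<lambda>b. b)"
    unfolding split_extension_def
  proof (intro conjI ballI)
    show "(\<lambda>a. a) \<in> gwo_hom C A G" "(\<lambda>b. b) \<in> gwo_hom C B G"
      using Ac(1) Bc(1) by (auto simp: gwo_hom_def hom_def opsA opsB)
    show "s \<in> gwo_hom C G B"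
      using s by (auto simp: gwo_hom_def hom_def opsB cB)
    show "(\<lambda>a. a) ` carrier A = kernel G B s"
      by (simp add: cA opsB kernel_def)
    show "s b = b" if "b \<in> carrier B" for b by (rule Bc(2)[OF that])
    show "inj_on (\<lambda>a. a) (carrier A)" by (rule inj_onI)
  qed (rule oG oA oB cB[symmetric])+
  have "induces_action C A G B (\<lambda>a. a) (\<lambda>b. b)
      (\<lambda>b a. b \<otimes>\<^bsub>G\<^esub> a \<otimes>\<^bsub>G\<^esub> inv\<^bsub>G\<^esub> b) (\<lambda>f b a. binop G f b a)"
    using dotA starA Bc(1) by (auto simp: induces_action_def)
  from derived_actionsI[OF C ext this]
  have der: "derived_actions C B A (\<lambda>b a. b \<otimes>\<^bsub>G\<^esub> a \<otimes>\<^bsub>G\<^esub> inv\<^bsub>G\<^esub> b) (\<lambda>f b a. binop G f b a)" .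
  have hom: "restrict t (carrier A) \<in> gwo_hom C A B"
    using t Ac(1) tB object_closed[OF oA]
    by (auto simp: gwo_hom_def hom_def opsA opsB)
  have precrossed: "t (b \<otimes>\<^bsub>G\<^esub> a \<otimes>\<^bsub>G\<^esub> inv\<^bsub>G\<^esub> b) = b \<otimes>\<^bsub>B\<^esub> t a \<otimes>\<^bsub>B\<^esub> inv\<^bsub>B\<^esub> b"
    if "b \<in> carrier B" "a \<in> carrier A" for a b
    using Ac[OF that(2)] Bc[OF that(1)] by (simp add: opsB invB[OF that(1)])
  have peiffer: "t a \<otimes>\<^bsub>G\<^esub> a' \<otimes>\<^bsub>G\<^esub> inv\<^bsub>G\<^esub> (t a) = a \<otimes>\<^bsub>A\<^esub> a' \<otimes>\<^bsub>A\<^esub> inv\<^bsub>A\<^esub> a"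
    if a: "a \<in> carrier A" and a': "a' \<in> carrier A" for a a'
  proof -
    note [simp] = Ac(1)[OF a] Ac(1)[OF a'] d(2)[OF Ac(1)[OF a]]
    have "t a \<otimes>\<^bsub>G\<^esub> a' = a \<otimes>\<^bsub>G\<^esub> (d a \<otimes>\<^bsub>G\<^esub> a')"
      using d(3)[of a] by (simp add: s.m_assoc)
    also have "\<dots> = a \<otimes>\<^bsub>G\<^esub> (a' \<otimes>\<^bsub>G\<^esub> d a)"
      using comm[of a' "d a"] a' d(1)[of a] by (simp add: cA)
    also have "\<dots> = a \<otimes>\<^bsub>G\<^esub> a' \<otimes>\<^bsub>G\<^esub> inv\<^bsub>G\<^esub> a \<otimes>\<^bsub>G\<^esub> t a"
      by (simp add: d_def s.m_assoc)
    finally show ?thesis by (simp add: opsA invA[OF a] s.m_assoc)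
  qed
  have peiffer_star: "binop G f (t a) a' = binop A f a a'"
    if f: "f \<in> binops C" and a: "a \<in> carrier A" and a': "a' \<in> carrier A" for f a a'
  proof -
    note [simp] = Ac(1)[OF a] Ac(1)[OF a'] d(2)[OF Ac(1)[OF a]]
    \<comment> \<open>The annihilation condition has the element of \<open>ker s\<close> on the left, hence the opposite.\<close>
    have "binop G f (d a) a' = \<one>\<^bsub>G\<^esub>"
      using ann[OF opp[OF f], of a' "d a"] a' d(1)[of a] by (simp add: cA object_binop_opp[OF C oG f])
    then show ?thesis
      using object_binop_distrib_left[OF C oG f, of a "d a" a'] object_closed(5)[OF oG f, of a a']
        d(3)[of a] by (simp add: opsA)
  qed
  have equivariant: "t (binop G f b a) = binop B f b (t a)"
    "t (binop G (opp C f) b a) = binop B f (t a) b"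
    if f: "f \<in> binops C" and b: "b \<in> carrier B" and a: "a \<in> carrier A" for f a b
    using t f Ac(1)[OF a] Bc[OF b]
    by (auto simp: opsB gwo_hom_def object_binop_opp[OF C oG f])
  have X: "xmod_of_cat1 Q = \<lparr>xdom = A, xcod = B, xmap = restrict t (carrier A),
      xdot = (\<lambda>b a. b \<otimes>\<^bsub>G\<^esub> a \<otimes>\<^bsub>G\<^esub> inv\<^bsub>G\<^esub> b), xstar = (\<lambda>f b a. binop G f b a)\<rparr>"
    by (simp add: xmod_of_cat1_def Let_def A_def B_def G_def s_def t_def)
  show ?thesis
    unfolding X crossed_module_def Let_def
    using oA oB der hom precrossed peiffer peiffer_star equivariant dotA starA Bc(1) opp
    by simp
qed


section \<open>Normality\<close>

theorem theorem6p9: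
  fixes C :: "('u, 'o) gwo_category"
    and G N :: "('a, 'u, 'o) gwo"
    and s\<^sub>G t\<^sub>G s\<^sub>N t\<^sub>N :: "'a \<Rightarrow> 'a"
    and X Y :: "('a, 'a, 'u, 'o) xmod"
  assumes "gwo_category C"
    and "cat1_group C \<lparr>cgrp = G, csrc = s\<^sub>G, ctgt = t\<^sub>G\<rparr>"
    and "normal_subcat1_group C \<lparr>cgrp = N, csrc = s\<^sub>N, ctgt = t\<^sub>N\<rparr> \<lparr>cgrp = G, csrc = s\<^sub>G, ctgt = t\<^sub>G\<rparr>"
    and "X = xmod_of_cat1 \<lparr>cgrp = G, csrc = s\<^sub>G, ctgt = t\<^sub>G\<rparr>"
    and "Y = xmod_of_cat1 \<lparr>cgrp = N, csrc = s\<^sub>N, ctgt = t\<^sub>N\<rparr>"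
  shows "normal_subcrossed_module C Y X"
proof -
  note C = assms(1) and Q = assms(2)
  have P: "cat1_group C \<lparr>cgrp = N, csrc = s\<^sub>N, ctgt = t\<^sub>N\<rparr>"
    and ideal: "gwo_ideal C N G"
    and seq: "\<And>x. x \<in> carrier N \<Longrightarrow> s\<^sub>N x = s\<^sub>G x"
    and teq: "\<And>x. x \<in> carrier N \<Longrightarrow> t\<^sub>N x = t\<^sub>G x"
    using assms(3) by (auto simp: normal_subcat1_group_def)
  have oG: "gwo_object C G" and oN: "gwo_object C N"
    and sG: "s\<^sub>G \<in> gwo_hom C G G" and sN: "s\<^sub>N \<in> gwo_hom C N N"
    using P Q by (auto simp: cat1_group_def Let_def)
  have ss: "\<And>x. x \<in> carrier G \<Longrightarrow> s\<^sub>G (s\<^sub>G x) = s\<^sub>G x"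
    using cat1_group_retraction(1)[OF Q] by simp
  interpret s: group_hom G G s\<^sub>G by (rule gwo_hom_group_hom[OF C oG oG sG])
  interpret N: normal "carrier N" G using ideal by (simp add: gwo_ideal_def)
  have subN: "gwo_subobject C N G" using ideal by (simp add: gwo_ideal_def)
  define A B S T where "A = G\<lparr>carrier := kernel G G s\<^sub>G\<rparr>" and "B = G\<lparr>carrier := s\<^sub>G ` carrier G\<rparr>"
    and "S = N\<lparr>carrier := kernel N N s\<^sub>N\<rparr>" and "T = N\<lparr>carrier := s\<^sub>N ` carrier N\<rparr>"
  have X: "X = \<lparr>xdom = A, xcod = B, xmap = restrict t\<^sub>G (kernel G G s\<^sub>G),
      xdot = (\<lambda>b a. b \<otimes>\<^bsub>G\<^esub> a \<otimes>\<^bsub>G\<^esub> inv\<^bsub>G\<^esub> b), xstar = (\<lambda>f b a. binop G f b a)\<rparr>"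
    and Y: "Y = \<lparr>xdom = S, xcod = T, xmap = restrict t\<^sub>N (kernel N N s\<^sub>N),
      xdot = (\<lambda>b a. b \<otimes>\<^bsub>N\<^esub> a \<otimes>\<^bsub>N\<^esub> inv\<^bsub>N\<^esub> b), xstar = (\<lambda>f b a. binop N f b a)\<rparr>"
    by (simp_all add: assms(4,5) xmod_of_cat1_def Let_def A_def B_def S_def T_def)
  have cmX: "crossed_module C X" and cmY: "crossed_module C Y"
    unfolding assms(4,5) using crossed_module_of_cat1_group[OF C] P Q by blast+
  have Neq: "\<one>\<^bsub>N\<^esub> = \<one>\<^bsub>G\<^esub>"
    "x \<in> carrier N \<Longrightarrow> inv\<^bsub>N\<^esub> x = inv\<^bsub>G\<^esub> x"
    "x \<in> carrier N \<Longrightarrow> y \<in> carrier N \<Longrightarrow> x \<otimes>\<^bsub>N\<^esub> y = x \<otimes>\<^bsub>G\<^esub> y"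
    "f \<in> binops C \<Longrightarrow> x \<in> carrier N \<Longrightarrow> y \<in> carrier N \<Longrightarrow> binop N f x y = binop G f x y"
    for x y f
    using subN by (auto simp: gwo_subobject_def)
  have idA: "gwo_ideal C A G" unfolding A_def by (rule kernel_ideal[OF C oG oG sG])
  then have subA: "gwo_subobject C A G" by (simp add: gwo_ideal_def)
  have subB: "gwo_subobject C B G" unfolding B_def by (rule image_subobject[OF C oG oG sG])
  have "gwo_subobject C S N"
    using kernel_ideal[OF C oN oN sN] by (simp add: gwo_ideal_def S_def)
  then have subS: "gwo_subobject C S G" by (rule subobject_trans[OF C oG _ subN])
  have "gwo_subobject C T N" unfolding T_def by (rule image_subobject[OF C oN oN sN])
  then have subT: "gwo_subobject C T G" by (rule subobject_trans[OF C oG _ subN])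
  have cA: "carrier A = kernel G G s\<^sub>G" and cB: "carrier B = s\<^sub>G ` carrier G"
    and cT: "carrier T = s\<^sub>G ` carrier N"
    using seq by (auto simp: A_def B_def T_def)
  \<comment> \<open>This and \<open>TI\<close> below reduce membership in \<open>S\<close> and \<open>T\<close> to membership in \<open>N\<close>.\<close>
  have cS: "carrier S = carrier N \<inter> carrier A"
    using seq N.subset by (auto simp: S_def A_def kernel_def Neq(1))
  have TN: "carrier T \<subseteq> carrier N"
    using sN by (auto simp: T_def gwo_hom_def hom_def)
  have SA: "gwo_subobject C S A" by (rule subobject_mono[OF C oG subS subA]) (auto simp: cS)
  have TB: "gwo_subobject C T B"
    by (rule subobject_mono[OF C oG subT subB]) (use N.subset in \<open>auto simp: cT cB\<close>)
  have BG: "b \<in> carrier G" "s\<^sub>G b = b" if "b \<in> carrier B" for b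
    using that ss by (auto simp: cB)
  have AG: "a \<in> carrier G" "s\<^sub>G a = \<one>\<^bsub>G\<^esub>" if "a \<in> carrier A" for a
    using that by (auto simp: cA kernel_def)
  have TG: "t \<in> carrier N" "t \<in> carrier B" "t \<in> carrier G" if "t \<in> carrier T" for t
    using that TN N.subset cT cB by auto
  have conjN: "b \<otimes>\<^bsub>G\<^esub> n \<otimes>\<^bsub>G\<^esub> inv\<^bsub>G\<^esub> b \<in> carrier N" if "b \<in> carrier G" "n \<in> carrier N" for b n
    using N.inv_op_closed2[OF that] .
  have starN: "binop G f a n \<in> carrier N" if "f \<in> binops C" "a \<in> carrier G" "n \<in> carrier N" for f a n
    using ideal that by (simp add: gwo_ideal_def)
  have opp: "opp C f \<in> binops C" if "f \<in> binops C" for f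
    using C that by (auto simp: gwo_category_def)
  have starN': "binop G f n a \<in> carrier N" if "f \<in> binops C" "a \<in> carrier G" "n \<in> carrier N" for f a n
    using starN[OF opp, of f a n] that N.subset
    by (auto simp: object_binop_opp[OF C oG])
  have starA: "binop G f b a \<in> carrier A" if "f \<in> binops C" "b \<in> carrier G" "a \<in> carrier A" for f a b
    using idA that by (simp add: gwo_ideal_def)
  have conjA: "b \<otimes>\<^bsub>G\<^esub> a \<otimes>\<^bsub>G\<^esub> inv\<^bsub>G\<^esub> b \<in> carrier A" if "b \<in> carrier G" "a \<in> carrier A" for a b
    using that AG[OF that(2)] by (simp add: cA kernel_def)
  have TI: "x \<in> carrier T" if "x \<in> carrier N" "x \<in> carrier B" for x
    using that BG(2)[of x] unfolding cT by (metis image_eqI)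
  have invB: "inv\<^bsub>B\<^esub> b = inv\<^bsub>G\<^esub> b" if "b \<in> carrier B" for b
    using subB that by (simp add: gwo_subobject_def)
  have invA: "inv\<^bsub>A\<^esub> a = inv\<^bsub>G\<^esub> a" if "a \<in> carrier A" for a
    using subA that by (simp add: gwo_subobject_def)
  have oB: "gwo_object C B" by (rule subobject_object[OF C oG subB])
  have opsB: "mult B = mult G" "binop B = binop G" and opsA: "mult A = mult G"
    by (simp_all add: A_def B_def)
  have idT: "gwo_ideal C T B"
    unfolding gwo_ideal_def
  proof (intro conjI ballI)
    show "gwo_subobject C T B" by (rule TB)
  next
    interpret B: group B by (rule object_group[OF C oB])
    show "carrier T \<lhd> B"
      unfolding B.normal_inv_iff
    proof (intro conjI ballI)
      show "subgroup (carrier T) B" using TB by (simp add: gwo_subobject_def)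
      fix b h assume b: "b \<in> carrier B" and h: "h \<in> carrier T"
      have "b \<otimes>\<^bsub>B\<^esub> h \<otimes>\<^bsub>B\<^esub> inv\<^bsub>B\<^esub> b \<in> carrier B"
        using b TG(2)[OF h] by simp
      moreover have "b \<otimes>\<^bsub>B\<^esub> h \<otimes>\<^bsub>B\<^esub> inv\<^bsub>B\<^esub> b \<in> carrier N"
        using conjN BG(1)[OF b] TG(1)[OF h] by (simp add: opsB invB[OF b])
      ultimately show "b \<otimes>\<^bsub>B\<^esub> h \<otimes>\<^bsub>B\<^esub> inv\<^bsub>B\<^esub> b \<in> carrier T" by (rule TI[rotated])
    qed
  next
    fix f b n assume f: "f \<in> binops C" and b: "b \<in> carrier B" and n: "n \<in> carrier T"
    have "binop B f b n \<in> carrier N"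
      using starN[OF f BG(1)[OF b] TG(1)[OF n]] by (simp add: opsB)
    then show "binop B f b n \<in> carrier T"
      by (rule TI) (rule object_closed(5)[OF oB f b TG(2)[OF n]])
  qed
  have comm: "t \<otimes>\<^bsub>G\<^esub> a \<otimes>\<^bsub>G\<^esub> inv\<^bsub>G\<^esub> t \<otimes>\<^bsub>G\<^esub> inv\<^bsub>G\<^esub> a \<in> carrier S"
    if t: "t \<in> carrier T" and a: "a \<in> carrier A" for t a
  proof -
    note [simp] = TG(3)[OF t] AG[OF a]
    \<comment> \<open>Bracketed as \<open>t + (a - t - a)\<close>, the commutator lies in \<open>N\<close> by normality of \<open>N\<close>;
        it lies in \<open>A\<close> because \<open>s\<close> kills \<open>a\<close>.\<close>
    have "t \<otimes>\<^bsub>G\<^esub> (a \<otimes>\<^bsub>G\<^esub> inv\<^bsub>G\<^esub> t \<otimes>\<^bsub>G\<^esub> inv\<^bsub>G\<^esub> a) \<in> carrier N"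
      using conjN[of a "inv\<^bsub>G\<^esub> t"] TG(1)[OF t] by simp
    moreover have "t \<otimes>\<^bsub>G\<^esub> a \<otimes>\<^bsub>G\<^esub> inv\<^bsub>G\<^esub> t \<otimes>\<^bsub>G\<^esub> inv\<^bsub>G\<^esub> a \<in> carrier A"
      by (simp add: cA kernel_def)
    ultimately show ?thesis by (simp add: cS s.m_assoc)
  qed
  have "subcrossed_module C Y X"
    unfolding subcrossed_module_def
    using cmX cmY SA TB teq Neq TN cS
    by (auto simp: X Y S_def cA kernel_def subset_iff)
  then show ?thesis
    unfolding normal_subcrossed_module_def Let_def
    using idT comm conjN conjA starN starN' starA BG(1) TG AG(1)
    by (auto simp: X Y cS opsA invA)
qed

end
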